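(* Let $I,J\ge 1$ be integers and consider the regression model $$Y_{ijt}=\alpha_i+\beta_j+\mu_{ij}+X_{ijt}'\gamma+\varepsilon_{ijt},\qquad i=1,\dots,I,\ j=1,\dots,J,\ t=1,\dots,T,$$ with real absolute fixed effects $\alpha=(\alpha_i)\in\mathbb{R}^I$, $\beta=(\beta_j)\in\mathbb{R}^J$ and absolute match effects $\mu=(\mu_{ij})\in\mathbb{R}^{I\times J}$. Fix an arbitrary reference student $i_0\in\{1,\dots,I\}$ and reference teacher $j_0\in\{1,\dots,J\}$, and let the relative fixed effects of $(\alpha,\beta,\mu)$ be the family of numbers $$\alpha'_i=\alpha_i-\alpha_{i_0}+\mu_{ij_0}-\mu_{i_0j_0},\qquad \beta'_j=\beta_j-\beta_{j_0}+\mu_{i_0j}-\mu_{i_0j_0},\qquad \mu'_{ij}=\mu_{ij}+\mu_{i_0j_0}-\mu_{ij_0}-\mu_{i_0j}$$ over all $i\in\{1,\dots,I\}$ and $j\in\{1,\dots,J\}$. Then the following hold. 1. Without any restriction on $(\alpha,\beta,\mu)\in\mathbb{R}^I\times\mathbb{R}^J\times\mathbb{R}^{I\times J}$, the absolute match effect $\mu_{ij}$ is not identified by the relative fixed effects, for any $i$ and $j$. 2. Under the restriction that $\sum_{i=1}^I\mu_{ij}=0$ for every $j$ and $\sum_{j=1}^J\mu_{ij}=0$ for every $i$, the absolute match effect $\mu_{ij}$ is identified by the relative fixed effects, for all $i$ and $j$. 3. Under the restriction that $\sum_{i=1}^I\mu_{ij}=0$ for every $j$, $\sum_{j=1}^J\mu_{ij}=0$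 for every $i$, $\sum_{i=1}^I\alpha_i=0$ and $\sum_{j=1}^J\beta_j=0$, the absolute fixed effects $\alpha_i$ and $\beta_j$ and the absolute match effect $\mu_{ij}$ are identified by the relative fixed effects, for all $i$ and $j$.
   Context: In the model, $Y_{ijt}$ is the outcome (test score) of student $i$ with teacher $j$ at time $t$, $X_{ijt}$ is a $d$-dimensional vector of observed covariates, $\gamma\in\mathbb{R}^d$ is a parameter vector, and $\varepsilon_{ijt}$ is an i.i.d. standard normal error. The parameters $\alpha_i$, $\beta_j$, $\mu_{ij}$ are called the absolute student, teacher and match effects. To avoid multicollinearity, the regression is rewritten relative to a reference student and teacher; its estimable coefficients include the relative fixed effects $\alpha'_i$ (student), $\beta'_j$ (teacher) and $\mu'_{ij}$ (match) defined in the claim. The relative fixed effects are treated as known, and the question is whether the linear system defining them can be solved uniquely for the absolute effects. Identification: let $\Theta\subseteq\mathbb{R}^I\times\mathbb{R}^J\times\mathbb{R}^{I\times J}$ be the set of parameters $(\alpha,\beta,\mu)$ satisfying the restrictions imposed (with no restriction, $\Theta$ is the whole space). A coordinate of the parameter (some $\alpha_i$, $\beta_j$ or $\mu_{ij}$) is identified by the relative fixed effects under the restrictions if any two elements of $\Theta$ having the same relative fixed effects have the same value of that coordinate. It is not identified if there exist two elements of $\Theta$ with the same relative fixed effects but different values of that coordinate. *)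

theory Defs
  imports "HOL-Analysis.Analysis"
begin

(* Students are indexed by the type 'i and teachers by the type 'j, so I = CARD('i) >= 1 and
   J = CARD('j) >= 1.  A parameter is a triple (alpha, beta, mu), with mu $ i $ j for mu_ij. *)

type_synonym ('i, 'j) effects = "(real ^ 'i) \<times> (real ^ 'j) \<times> (real ^ 'j ^ 'i)"

definition student_effect :: "'i \<Rightarrow> ('i::finite, 'j::finite) effects \<Rightarrow> real" where
  "student_effect i = (\<lambda>(\<alpha>, \<beta>, \<mu>). \<alpha> $ i)"

definition teacher_effect :: "'j \<Rightarrow> ('i::finite, 'j::finite) effects \<Rightarrow> real" where
  "teacher_effect j = (\<lambda>(\<alpha>, \<beta>, \<mu>). \<beta> $ j)"

definition match_effect :: "'i \<Rightarrow> 'j \<Rightarrow> ('i::finite, 'j::finite) effects \<Rightarrow> real" where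
  "match_effect i j = (\<lambda>(\<alpha>, \<beta>, \<mu>). \<mu> $ i $ j)"

(* The whole family (alpha', beta', mu'), relative to the reference student i0 and teacher j0. *)

definition relative_effects ::
    "'i \<Rightarrow> 'j \<Rightarrow> ('i::finite, 'j::finite) effects \<Rightarrow> ('i, 'j) effects" where
  "relative_effects i0 j0 = (\<lambda>(\<alpha>, \<beta>, \<mu>).
     ((\<chi> i. \<alpha> $ i - \<alpha> $ i0 + \<mu> $ i $ j0 - \<mu> $ i0 $ j0),
      (\<chi> j. \<beta> $ j - \<beta> $ j0 + \<mu> $ i0 $ j - \<mu> $ i0 $ j0),
      (\<chi> i j. \<mu> $ i $ j + \<mu> $ i0 $ j0 - \<mu> $ i $ j0 - \<mu> $ i0 $ j)))"

definition identified ::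
    "'p set \<Rightarrow> ('p \<Rightarrow> 'r) \<Rightarrow> ('p \<Rightarrow> real) \<Rightarrow> bool" where
  "identified \<Theta> rel coord \<longleftrightarrow>
     (\<forall>\<theta>\<in>\<Theta>. \<forall>\<theta>'\<in>\<Theta>. rel \<theta> = rel \<theta>' \<longrightarrow> coord \<theta> = coord \<theta>')"

definition zero_sum_match :: "('i::finite, 'j::finite) effects set" where
  "zero_sum_match = {(\<alpha>, \<beta>, \<mu>).
     (\<forall>j. (\<Sum>i\<in>UNIV. \<mu> $ i $ j) = 0) \<and> (\<forall>i. (\<Sum>j\<in>UNIV. \<mu> $ i $ j) = 0)}"

definition zero_sum_all :: "('i::finite, 'j::finite) effects set" where
  "zero_sum_all = {(\<alpha>, \<beta>, \<mu>).
     (\<forall>j. (\<Sum>i\<in>UNIV. \<mu> $ i $ j) = 0) \<and> (\<forall>i. (\<Sum>j\<in>UNIV. \<mu> $ i $ j) = 0) \<and>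
     (\<Sum>i\<in>UNIV. \<alpha> $ i) = 0 \<and> (\<Sum>j\<in>UNIV. \<beta> $ j) = 0}"

end

(* Adding 1 to every match effect changes no relative effect, so no match effect is identified
   without restrictions. Conversely, equal relative match effects mean that the difference of two
   match matrices is additively separable, d i j = a i + b j. Its column differences d i j - d i j'
   then do not depend on i and sum to zero over i, so they vanish; hence each row is constant, and
   it vanishes too since its sum is zero. Once the match effects agree, the student and teacher
   effects differ by a constant, which the zero-sum restrictions force to be 0. *)
theory Submission
  imports Defs
begin

lemma constant_sum_zero:
  fixes f :: "'a::finite \<Rightarrow> real"
  assumes const: "\<And>x. f x = f a" and "(\<Sum>x\<in>UNIV. f x) = 0"
  shows "f x = 0"
proof -
  have "(\<Sum>x\<in>UNIV. f x) = (\<Sum>x\<in>(UNIV::'a set). f a)"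
    by (rule sum.cong) (rule refl, rule const)
  \<comment> \<open>Types are inhabited, so \<open>CARD('a)\<close> is positive and can be
    cancelled.\<close>
  then have "real CARD('a) * f a = 0"
    using assms(2) by simp
  then show ?thesis
    using const[of x] by simp
qed

text \<open>Kernel form of uniqueness: \<open>additive\<close> expresses that all relative match
  effects of \<open>d\<close> vanish.\<close>

lemma additive_zero_sums_zero:
  fixes d :: "'i::finite \<Rightarrow> 'j::finite \<Rightarrow> real"
  assumes additive: "\<And>i j. d i j = d i j0 + d i0 j - d i0 j0"
    and cols: "\<And>j. (\<Sum>i\<in>UNIV. d i j) = 0"
    and rows: "\<And>i. (\<Sum>j\<in>UNIV. d i j) = 0"
  shows "d i j = 0"
proof -
  have "d i j - d i j0 = 0" for i j
  proof (rule constant_sum_zero[where f = "\<lambda>i. d i j - d i j0" and a = i0])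
    show "d i j - d i j0 = d i0 j - d i0 j0" for i
      using additive[of i j] by simp
  qed (simp add: sum_subtractf cols)
  then have "d i j = d i j0" for j
    by simp
  then show ?thesis
    by (rule constant_sum_zero[where f = "d i"]) (rule rows)
qed

lemma not_identified_match_effect:
  "\<not> identified UNIV (relative_effects i0 j0) (match_effect i j)"
proof -
  \<comment> \<open>In each relative effect the coefficients of the match terms add up to 0, so a
    constant matrix cancels.\<close>
  have "relative_effects i0 j0 (0, 0, \<chi> i j. 1) = relative_effects i0 j0 (0, 0, 0)"
    by (simp add: relative_effects_def vec_eq_iff)
  moreover have "match_effect i j (0, 0, \<chi> i j. 1) \<noteq> match_effect i j (0, 0, 0)"
    by (simp add: match_effect_def)
  ultimately show ?thesis
    unfolding identified_def by blast
qed

lemma zero_sum_match_unique: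
  assumes "(\<alpha>, \<beta>, \<mu>) \<in> zero_sum_match" "(\<alpha>', \<beta>', \<mu>') \<in> zero_sum_match"
    and rel: "relative_effects i0 j0 (\<alpha>, \<beta>, \<mu>) = relative_effects i0 j0 (\<alpha>', \<beta>', \<mu>')"
  shows "\<mu> = \<mu>'"
proof -
  let ?d = "\<lambda>i j. \<mu> $ i $ j - \<mu>' $ i $ j"
  have "?d i j = 0" for i j
  proof (rule additive_zero_sums_zero[where d = ?d])
    fix i j
    have "\<mu> $ i $ j + \<mu> $ i0 $ j0 - \<mu> $ i $ j0 - \<mu> $ i0 $ j =
        \<mu>' $ i $ j + \<mu>' $ i0 $ j0 - \<mu>' $ i $ j0 - \<mu>' $ i0 $ j"
      using rel by (simp add: relative_effects_def vec_eq_iff)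
    then show "?d i j = ?d i j0 + ?d i0 j - ?d i0 j0"
      by simp
  qed (use assms(1,2) in \<open>simp_all add: zero_sum_match_def sum_subtractf\<close>)
  then show ?thesis
    by (simp add: vec_eq_iff)
qed

text \<open>Serves students and teachers alike: \<open>diff\<close> is what equality of their
  relative effects reduces to once the match matrices agree.\<close>

lemma zero_sum_unique:
  fixes x y :: "real ^ 'n"
  assumes diff: "\<And>k. x $ k - x $ a = y $ k - y $ a"
    and "(\<Sum>k\<in>UNIV. x $ k) = 0" "(\<Sum>k\<in>UNIV. y $ k) = 0"
  shows "x = y"
proof -
  have "x $ k - y $ k = 0" for k
  proof (rule constant_sum_zero[where f = "\<lambda>k. x $ k - y $ k" and a = a])
    show "x $ k - y $ k = x $ a - y $ a" for k
      using diff[of k] by simp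
  qed (simp add: sum_subtractf assms(2,3))
  then show ?thesis
    by (simp add: vec_eq_iff)
qed

lemma zero_sum_all_subset: "zero_sum_all \<subseteq> zero_sum_match"
  by (auto simp: zero_sum_all_def zero_sum_match_def)

text \<open>Recovering the whole parameter settles student, teacher and match effects at
  once.\<close>

lemma inj_on_relative_effects:
  fixes i0 :: "'a::finite" and j0 :: "'b::finite"
  shows "inj_on (relative_effects i0 j0) zero_sum_all"
proof (rule inj_onI)
  fix \<theta> \<theta>' :: "('a, 'b) effects"
  obtain \<alpha> \<beta> \<mu> \<alpha>' \<beta>' \<mu>' where \<theta>: "\<theta> = (\<alpha>, \<beta>, \<mu>)" "\<theta>' = (\<alpha>', \<beta>', \<mu>')"
    by (metis prod_cases3)
  assume "\<theta> \<in> zero_sum_all" "\<theta>' \<in> zero_sum_all"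
    and "relative_effects i0 j0 \<theta> = relative_effects i0 j0 \<theta>'"
  then have in_all: "(\<alpha>, \<beta>, \<mu>) \<in> zero_sum_all" "(\<alpha>', \<beta>', \<mu>') \<in> zero_sum_all"
    and rel: "relative_effects i0 j0 (\<alpha>, \<beta>, \<mu>) = relative_effects i0 j0 (\<alpha>', \<beta>', \<mu>')"
    by (simp_all only: \<theta>)
  \<comment> \<open>The match effects come first, since the relative student and teacher effects
    also contain match terms, which cancel only after this.\<close>
  have \<mu>: "\<mu> = \<mu>'"
    using zero_sum_match_unique[OF _ _ rel] in_all zero_sum_all_subset by blast
  have \<alpha>: "\<alpha> = \<alpha>'"
    by (rule zero_sum_unique[where a = i0])
      (use rel in_all in \<open>simp_all add: \<mu> relative_effects_def vec_eq_iff zero_sum_all_def\<close>)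
  have \<beta>: "\<beta> = \<beta>'"
    by (rule zero_sum_unique[where a = j0])
      (use rel in_all in \<open>simp_all add: \<mu> relative_effects_def vec_eq_iff zero_sum_all_def\<close>)
  show "\<theta> = \<theta>'"
    by (simp only: \<theta> \<alpha> \<beta> \<mu>)
qed

text \<open>Under injectivity equal relative effects force equal parameters, whatever coordinate is
  then read off.\<close>

lemma inj_on_imp_identified:
  assumes "inj_on rel \<Theta>"
  shows "identified \<Theta> rel coord"
  using assms by (auto simp: identified_def dest: inj_onD)

lemma identified_match_effect:
  "identified zero_sum_match (relative_effects i0 j0) (match_effect i j)"
  unfolding identified_def match_effect_def
  by (auto dest: zero_sum_match_unique)

theorem proposition1:
  fixes i0 :: "'i::finite" and j0 :: "'j::finite"
  shows "(\<forall>(i::'i) (j::'j).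
            \<not> identified UNIV (relative_effects i0 j0) (match_effect i j)) \<and>
         (\<forall>(i::'i) (j::'j).
            identified zero_sum_match (relative_effects i0 j0) (match_effect i j)) \<and>
         (\<forall>(i::'i) (j::'j).
            identified zero_sum_all (relative_effects i0 j0) (student_effect i) \<and>
            identified zero_sum_all (relative_effects i0 j0) (teacher_effect j) \<and>
            identified zero_sum_all (relative_effects i0 j0) (match_effect i j))"
  by (intro conjI allI not_identified_match_effect identified_match_effect
      inj_on_imp_identified inj_on_relative_effects)

end
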